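(* Let $m,n\geq 1$ be integers, let $\epsilon=(\epsilon_1,\ldots,\epsilon_{\min\{m,n\}})\in\{1,-1\}^{\min\{m,n\}}$ be a sign pattern, and let $A\in\mathbb{R}^{m\times n}$ be an SSR$(\epsilon)$ matrix. Then between any two consecutive columns of $A$ (respectively, any two consecutive rows of $A$) one can insert a column in $\mathbb{R}^m$ (respectively, a row in $\mathbb{R}^n$), leaving the entries of $A$ unchanged, so that the resulting $m\times(n+1)$ (respectively, $(m+1)\times n$) matrix is SSR$(\epsilon')$ for a sign pattern $\epsilon'$ with $\epsilon'_i=\epsilon_i$ for $i=1,\ldots,\min\{m,n\}$. Moreover, if the resulting matrix has minors of size $\min\{m,n\}+1$, then this can be achieved with $\epsilon'_{\min\{m,n\}+1}=1$, and it can also be achieved with $\epsilon'_{\min\{m,n\}+1}=-1$.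
   Context: All matrices are real. For $\epsilon=(\epsilon_1,\ldots,\epsilon_{\min\{m,n\}})\in\{1,-1\}^{\min\{m,n\}}$, an $m\times n$ matrix is strictly sign regular with sign pattern $\epsilon$, written SSR$(\epsilon)$, if for every $1\leq k\leq\min\{m,n\}$ all its $k\times k$ minors are non-zero and have sign $\epsilon_k$. Here the $k\times k$ minors are the determinants of the submatrices with rows $I$ and columns $J$, $|I|=|J|=k$, rows and columns kept in increasing order. *)

theory Defs
  imports Complex_Main "Jordan_Normal_Form.DL_Submatrix" "Jordan_Normal_Form.Determinant"
begin

(* A sign pattern (eps_1, ..., eps_N) is a function on nat, of which only the values at 1, ..., N
   matter: sign_pattern and SSR ignore eps at every other argument. *)
definition sign_pattern :: "nat \<Rightarrow> (nat \<Rightarrow> real) \<Rightarrow> bool" where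
  "sign_pattern N eps \<longleftrightarrow> (\<forall>k\<in>{1..N}. eps k \<in> {1, -1})"

definition SSR :: "(nat \<Rightarrow> real) \<Rightarrow> real mat \<Rightarrow> bool" where
  "SSR eps A \<longleftrightarrow>
     (\<forall>k\<in>{1..min (dim_row A) (dim_col A)}. \<forall>I J.
        I \<subseteq> {..<dim_row A} \<and> J \<subseteq> {..<dim_col A} \<and> card I = k \<and> card J = k \<longrightarrow>
        det (submatrix A I J) \<noteq> 0 \<and> sgn (det (submatrix A I J)) = eps k)"

(* Indices start at 0, so v becomes column p of the new matrix. For 0 < p < dim_col A it lies
   between the consecutive columns p - 1 and p of A. *)
definition insert_col :: "nat \<Rightarrow> 'a vec \<Rightarrow> 'a mat \<Rightarrow> 'a mat" where
  "insert_col p v A = mat (dim_row A) (dim_col A + 1)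
     (\<lambda>(i, j). if j < p then A $$ (i, j) else if j = p then v $ i else A $$ (i, j - 1))"

definition insert_row :: "nat \<Rightarrow> 'a vec \<Rightarrow> 'a mat \<Rightarrow> 'a mat" where
  "insert_row p v A = mat (dim_row A + 1) (dim_col A)
     (\<lambda>(i, j). if i < p then A $$ (i, j) else if i = p then v $ j else A $$ (i - 1, j))"

end

theory Submission
  imports Defs
begin

text \<open>
  Number the columns of \<open>A\<close> as \<open>c\<^sub>0, \<dots>, c\<^sub>n\<^sub>-\<^sub>1\<close> and let \<open>u\<^sub>0, u\<^sub>1, \<dots>\<close> be
  \<open>c\<^sub>p\<^sub>-\<^sub>1, -c\<^sub>p\<^sub>-\<^sub>2, c\<^sub>p\<^sub>-\<^sub>3, \<dots>, \<plusminus>c\<^sub>0, c\<^sub>p, -c\<^sub>p\<^sub>+\<^sub>1, \<dots>, \<plusminus>c\<^sub>n\<^sub>-\<^sub>1\<close>, followed by the unit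
  vectors, all with one common sign. The inserted column is \<open>\<Sum>t. d ^ t * u\<^sub>t\<close> for small \<open>d > 0\<close>.
  In a minor through it with old columns \<open>K\<close>, the terms with \<open>u\<^sub>t\<close> a column in \<open>K\<close> vanish. So if
  some column is missing from \<open>K\<close>, the minor has the sign of the first missing one, and sorting
  that column into \<open>K\<close> exactly compensates its sign in \<open>u\<^sub>t\<close>. If \<open>K\<close> contains all columns, the
  first unit vector that meets the rows of the minor dominates and leaves an \<open>n \<times> n\<close> minor of \<open>A\<close>;
  the common sign of the unit vectors then selects the sign of the minors of size \<open>n + 1\<close>.
\<close>

section \<open>Minors indexed by increasing functions\<close>

text \<open>A \<open>k\<close>-element index set is represented by its increasing enumeration, so
  that a minor becomes the determinant of an explicit matrix. Values of \<open>r\<close> outside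
  \<open>{..<k}\<close> are left free.\<close>

definition increasing_index :: "nat \<Rightarrow> nat \<Rightarrow> (nat \<Rightarrow> nat) \<Rightarrow> bool" where
  "increasing_index k N r \<longleftrightarrow> strict_mono_on {..<k} r \<and> r ` {..<k} \<subseteq> {..<N}"

definition minor :: "'a :: comm_ring_1 mat \<Rightarrow> nat \<Rightarrow> (nat \<Rightarrow> nat) \<Rightarrow> (nat \<Rightarrow> nat) \<Rightarrow> 'a" where
  "minor A k r c = det (mat k k (\<lambda>(a, b). A $$ (r a, c b)))"

lemma increasing_index_less:
  "increasing_index k N r \<Longrightarrow> a < b \<Longrightarrow> b < k \<Longrightarrow> r a < r b"
  by (auto simp: increasing_index_def strict_mono_on_def)

lemma increasing_index_less_iff:
  "increasing_index k N r \<Longrightarrow> a < k \<Longrightarrow> b < k \<Longrightarrow> r a < r b \<longleftrightarrow> a < b"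
  by (metis increasing_index_less not_less_iff_gr_or_eq)

lemma increasing_index_bound: "increasing_index k N r \<Longrightarrow> a < k \<Longrightarrow> r a < N"
  by (auto simp: increasing_index_def)

lemma increasing_index_inj: "increasing_index k N r \<Longrightarrow> inj_on r {..<k}"
  by (auto simp: increasing_index_def strict_mono_on_imp_inj_on)

lemma increasing_index_image_bound: "increasing_index k N r \<Longrightarrow> r ` {..<k} \<subseteq> {..<N}"
  by (simp add: increasing_index_def)

lemma increasing_index_card: "increasing_index k N r \<Longrightarrow> card (r ` {..<k}) = k"
  by (simp add: card_image increasing_index_inj)

lemma card_increasing_index_below:
  assumes "increasing_index k N r" "a < k"
  shows "card {x \<in> r ` {..<k}. x < r a} = a"
proof -
  have "{x \<in> r ` {..<k}. x < r a} = r ` {..<a}"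
    using assms increasing_index_less_iff[OF assms(1)] by force
  moreover have "inj_on r {..<a}"
    using increasing_index_inj[OF assms(1)] by (rule inj_on_subset) (use assms in auto)
  ultimately show ?thesis by (simp add: card_image)
qed

text \<open>\<open>pick\<close> recovers an element of a set from the number of smaller elements,
  and exactly \<open>a\<close> elements of the image lie below \<open>r a\<close>.\<close>

lemma pick_increasing_index:
  assumes "increasing_index k N r" "a < k"
  shows "pick (r ` {..<k}) a = r a"
  using pick_card_in_set[of "r a" "r ` {..<k}"] card_increasing_index_below[OF assms] assms
  by auto

lemma det_submatrix_image:
  assumes "A \<in> carrier_mat m n" "increasing_index k m r" "increasing_index k n c"
  shows "det (submatrix A (r ` {..<k}) (c ` {..<k})) = minor A k r c"
proof -
  have "{i. i < m \<and> i \<in> r ` {..<k}} = r ` {..<k}" "{i. i < n \<and> i \<in> c ` {..<k}} = c ` {..<k}"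
    using assms increasing_index_image_bound by blast+
  then have "submatrix A (r ` {..<k}) (c ` {..<k}) = mat k k (\<lambda>(a, b). A $$ (r a, c b))"
    using assms increasing_index_card pick_increasing_index
    by (auto intro!: eq_matI simp: submatrix_def)
  then show ?thesis by (simp add: minor_def)
qed

lemma obtain_increasing_index:
  assumes "I \<subseteq> {..<N}" "card I = k"
  obtains r where "increasing_index k N r" "I = r ` {..<k}"
proof
  have fin: "finite I" using assms(1) finite_subset by blast
  have sub: "pick I ` {..<k} \<subseteq> I" using pick_in_set_le[of _ I] assms by auto
  have mono: "strict_mono_on {..<k} (pick I)"
    by (auto simp: strict_mono_on_def assms intro!: pick_mono_le)
  show "increasing_index k N (pick I)"
    using sub mono assms by (auto simp: increasing_index_def)
  have "card (pick I ` {..<k}) = k"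
    using mono by (simp add: card_image strict_mono_on_imp_inj_on)
  then show "I = pick I ` {..<k}"
    using card_subset_eq[OF fin sub] assms by simp
qed

text \<open>Every \<open>k\<close>-element subset of \<open>{..<N}\<close> is the image of an
  increasing index function, so subsets and functions describe the same minors.\<close>

lemma SSR_iff_minor:
  assumes "A \<in> carrier_mat m n"
  shows "SSR eps A \<longleftrightarrow> (\<forall>k\<in>{1..min m n}. \<forall>r c. increasing_index k m r \<and> increasing_index k n c \<longrightarrow>
     minor A k r c \<noteq> 0 \<and> sgn (minor A k r c) = eps k)" (is "_ \<longleftrightarrow> ?R")
proof
  assume L: "SSR eps A"
  show ?R
  proof (intro ballI allI impI)
    fix k r c assume k: "k \<in> {1..min m n}" and rc: "increasing_index k m r \<and> increasing_index k n c"
    then show "minor A k r c \<noteq> 0 \<and> sgn (minor A k r c) = eps k"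
      using L assms det_submatrix_image[OF assms, of k r c] increasing_index_card
        increasing_index_image_bound
      unfolding SSR_def by (metis carrier_matD)
  qed
next
  assume R: ?R
  show "SSR eps A"
    unfolding SSR_def
  proof (intro ballI allI impI)
    fix k I J
    assume k: "k \<in> {1..min (dim_row A) (dim_col A)}"
      and IJ: "I \<subseteq> {..<dim_row A} \<and> J \<subseteq> {..<dim_col A} \<and> card I = k \<and> card J = k"
    obtain r where r: "increasing_index k m r" "I = r ` {..<k}"
      using obtain_increasing_index[of I m k] IJ assms by auto
    obtain c where c: "increasing_index k n c" "J = c ` {..<k}"
      using obtain_increasing_index[of J n k] IJ assms by auto
    show "det (submatrix A I J) \<noteq> 0 \<and> sgn (det (submatrix A I J)) = eps k"
      using R k assms r c det_submatrix_image[OF assms r(1) c(1)] by auto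
  qed
qed

section \<open>Transposition, which exchanges rows and columns\<close>

lemma minor_transpose:
  assumes "A \<in> carrier_mat m n" "increasing_index k m r" "increasing_index k n c"
  shows "minor (transpose_mat A) k c r = minor A k r c"
proof -
  have "mat k k (\<lambda>(a, b). transpose_mat A $$ (c a, r b))
      = transpose_mat (mat k k (\<lambda>(a, b). A $$ (r a, c b)))"
    using assms by (auto intro!: eq_matI simp: increasing_index_bound)
  then show ?thesis
    unfolding minor_def by (simp add: det_transpose[of _ k])
qed

lemma SSR_transpose:
  assumes "SSR eps A"
  shows "SSR eps (transpose_mat A)"
proof -
  let ?m = "dim_row A" and ?n = "dim_col A"
  have A: "A \<in> carrier_mat ?m ?n" and T: "transpose_mat A \<in> carrier_mat ?n ?m" by auto
  show ?thesis
    using assms unfolding SSR_iff_minor[OF A] SSR_iff_minor[OF T]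
    by (simp add: minor_transpose[OF A] min.commute)
qed

text \<open>Reduces the insertion of rows to that of columns.\<close>

lemma insert_row_transpose:
  assumes "A \<in> carrier_mat m n" "v \<in> carrier_vec n" "p \<le> m"
  shows "insert_row p v A = transpose_mat (insert_col p v (transpose_mat A))"
  using assms by (auto intro!: eq_matI simp: insert_row_def insert_col_def)


section \<open>Minors through the inserted column\<close>

text \<open>This is the determinant on the rows \<open>r\<close> with first column \<open>v\<close>,
  followed by the columns \<open>c\<close> of \<open>A\<close>, expanded along \<open>v\<close>. The
  expanded form makes linearity in \<open>v\<close> visible.\<close>

definition bordered_minor :: "'a :: comm_ring_1 mat \<Rightarrow> nat \<Rightarrow> (nat \<Rightarrow> nat) \<Rightarrow> (nat \<Rightarrow> nat) \<Rightarrow> (nat \<Rightarrow> 'a) \<Rightarrow> 'a" where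
  "bordered_minor A k r c v =
     (\<Sum>a<Suc k. (-1) ^ a * v (r a) * minor A k (\<lambda>i. r (if i < a then i else Suc i)) c)"

lemma bordered_minor_cong:
  assumes "\<And>a. a \<le> k \<Longrightarrow> v (r a) = w (r a)"
  shows "bordered_minor A k r c v = bordered_minor A k r c w"
  unfolding bordered_minor_def using assms by (intro sum.cong) auto

text \<open>Used to turn a minor through the inserted column into a polynomial in
  \<open>d\<close>.\<close>

lemma bordered_minor_sum:
  "bordered_minor A k r c (\<lambda>i. \<Sum>t\<in>T. f t * u t i) = (\<Sum>t\<in>T. f t * bordered_minor A k r c (u t))"
  unfolding bordered_minor_def sum_distrib_left sum_distrib_right
  by (subst sum.swap) (simp add: mult_ac)

lemma bordered_minor_scale:
  "bordered_minor A k r c (\<lambda>i. x * u i) = x * bordered_minor A k r c u"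
  unfolding bordered_minor_def sum_distrib_left by (simp add: mult_ac)

text \<open>Laplace expansion along column \<open>q\<close>: the position of the column only enters through a sign.\<close>
lemma det_column_at:
  fixes F :: "nat \<times> nat \<Rightarrow> 'a :: comm_ring_1"
  assumes q: "q \<le> k"
    and v: "\<And>a. a \<le> k \<Longrightarrow> F (a, q) = v (r a)"
    and c: "\<And>a b. a \<le> k \<Longrightarrow> b < k \<Longrightarrow> F (a, if b < q then b else Suc b) = A $$ (r a, c b)"
  shows "det (mat (Suc k) (Suc k) F) = (-1) ^ q * bordered_minor A k r c v"
proof -
  let ?M = "mat (Suc k) (Suc k) F"
  have del: "mat_delete ?M a q = mat k k (\<lambda>(i, j). A $$ (r (if i < a then i else Suc i), c j))"
    if "a < Suc k" for a
    using that q c by (auto intro!: eq_matI simp: mat_delete_def)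
  have "det ?M = (\<Sum>a<Suc k. ?M $$ (a, q) * cofactor ?M a q)"
    by (rule laplace_expansion_column) (use q in auto)
  also have "\<dots> = (\<Sum>a<Suc k. (-1) ^ q * ((-1) ^ a * v (r a) * minor A k (\<lambda>i. r (if i < a then i else Suc i)) c))"
    by (rule sum.cong) (use q v del in \<open>auto simp: cofactor_def minor_def power_add mult_ac\<close>)
  finally show ?thesis by (simp only: bordered_minor_def sum_distrib_left)
qed

text \<open>Up to sign this is a determinant with a repeated column.\<close>

lemma bordered_minor_old_column:
  fixes A :: "'a :: comm_ring_1 mat"
  assumes "b0 < k"
  shows "bordered_minor A k r c (\<lambda>i. A $$ (i, c b0)) = 0"
proof -
  \<comment> \<open>Column \<open>c b0\<close> of \<open>A\<close> stands at both positions
    \<open>b0\<close> and \<open>Suc b0\<close>; the copy at \<open>b0\<close> is the bordering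
    column.\<close>
  define F where "F = (\<lambda>(a, b). A $$ (r a, c (if b < b0 then b else if b = b0 then b0 else b - 1)))"
  have "det (mat (Suc k) (Suc k) F) = (-1) ^ b0 * bordered_minor A k r c (\<lambda>i. A $$ (i, c b0))"
    by (rule det_column_at) (use assms in \<open>auto simp: F_def\<close>)
  moreover have "det (mat (Suc k) (Suc k) F) = 0"
    by (rule det_identical_columns[of _ "Suc k" b0 "Suc b0"])
      (use assms in \<open>auto intro!: eq_vecI simp: F_def\<close>)
  ultimately show ?thesis
    by (cases "even b0") auto
qed

text \<open>The indices whose values lie below \<open>x\<close> form an initial segment, whose
  length is the number of such values.\<close>

lemma increasing_index_below_iff:
  assumes "increasing_index k N c" "b < k"
  shows "c b < x \<longleftrightarrow> b < card (c ` {..<k} \<inter> {..<x})"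
proof -
  let ?S = "{b. b < k \<and> c b < x}"
  have "c ` {..<k} \<inter> {..<x} = c ` ?S" by auto
  moreover have "inj_on c ?S"
    using increasing_index_inj[OF assms(1)] by (rule inj_on_subset) auto
  ultimately have card: "card (c ` {..<k} \<inter> {..<x}) = card ?S" by (simp add: card_image)
  show ?thesis
  proof
    assume "c b < x"
    then have "{..b} \<subseteq> ?S"
      using assms increasing_index_less[OF assms(1)] by (force simp: le_less)
    then have "card {..b} \<le> card ?S" by (intro card_mono) auto
    then show "b < card (c ` {..<k} \<inter> {..<x})" using card by simp
  next
    assume *: "b < card (c ` {..<k} \<inter> {..<x})"
    show "c b < x"
    proof (rule ccontr)
      assume "\<not> c b < x"
      then have "a < b" if "a < k" "c a < x" for a
        using that increasing_index_less_iff[OF assms(1) that(1) assms(2)] by simp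
      then have "?S \<subseteq> {..<b}" by auto
      then have "card ?S \<le> card {..<b}" by (intro card_mono) auto
      then show False using * card by simp
    qed
  qed
qed

text \<open>The place of \<open>j\<close> among the sorted columns is the number of columns of
  \<open>c\<close> below it, and expansion along that place gives the sign. One \<open>c'\<close>
  serves all choices of rows.\<close>

lemma bordered_minor_new_column:
  assumes c: "increasing_index k n c" and j: "j < n" "j \<notin> c ` {..<k}"
  obtains c' where "increasing_index (Suc k) n c'"
    "\<And>r. minor A (Suc k) r c' =
       (-1) ^ card (c ` {..<k} \<inter> {..<j}) * bordered_minor A k r c (\<lambda>i. A $$ (i, j))"
proof
  define q where "q = card (c ` {..<k} \<inter> {..<j})"
  define c' where "c' = (\<lambda>b. if b < q then c b else if b = q then j else c (b - 1))"
  have below: "c b < j \<longleftrightarrow> b < q" if "b < k" for b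
    using increasing_index_below_iff[OF c that] by (simp add: q_def)
  have neq: "c b \<noteq> j" if "b < k" for b using j(2) that by auto
  have qk: "q \<le> k"
    using card_mono[of "c ` {..<k}" "c ` {..<k} \<inter> {..<j}"] increasing_index_card[OF c]
    by (auto simp: q_def)
  have "c' a < c' b" if ab: "a < b" "b < Suc k" for a b
  proof -
    have b1: "b - 1 < k" using ab by simp
    consider "b < q" | "a < q" "b = q" | "a < q" "q < b" | "a = q" "q < b" | "q < a"
      using ab(1) by (cases a q rule: linorder_cases; cases b q rule: linorder_cases) simp_all
    then show ?thesis
    proof cases
      case 1
      then show ?thesis using ab qk increasing_index_less[OF c, of a b] by (simp add: c'_def)
    next
      case 2
      then show ?thesis using qk below[of a] by (simp add: c'_def)
    next
      case 3
      then show ?thesis using b1 increasing_index_less[OF c, of a "b - 1"] by (simp add: c'_def)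
    next
      case 4
      then have "\<not> b - 1 < q" by linarith
      with 4 show ?thesis using below[OF b1] neq[OF b1] by (auto simp: c'_def)
    next
      case 5
      then show ?thesis using ab b1 increasing_index_less[OF c, of "a - 1" "b - 1"] by (simp add: c'_def)
    qed
  qed
  moreover have "c' b < n" if "b < Suc k" for b
    using that qk j(1) increasing_index_bound[OF c] by (auto simp: c'_def)
  ultimately show "increasing_index (Suc k) n c'"
    by (auto simp: increasing_index_def strict_mono_on_def)
  show "minor A (Suc k) r c' = (-1) ^ q * bordered_minor A k r c (\<lambda>i. A $$ (i, j))" for r
    unfolding minor_def by (rule det_column_at) (use qk in \<open>auto simp: c'_def\<close>)
qed

text \<open>Without the inserted column the minor has only columns of \<open>A\<close>, and the
  inserted one stands after those that precede \<open>p\<close>. The index \<open>c\<close> is fixed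
  before \<open>v\<close>, so it stays the same while \<open>d\<close> varies.\<close>

lemma minor_insert_col:
  assumes A: "A \<in> carrier_mat m n" and p: "p \<le> n"
    and r: "increasing_index (Suc k) m r" and c': "increasing_index (Suc k) (Suc n) c'"
    and mem: "p \<in> c' ` {..<Suc k}"
  obtains c where "increasing_index k n c"
    "\<And>v. minor (insert_col p v A) (Suc k) r c' =
       (-1) ^ card (c ` {..<k} \<inter> {..<p}) * bordered_minor A k r c (\<lambda>i. v $ i)"
proof -
  obtain q where q: "q \<le> k" "c' q = p" using mem by (metis imageE lessThan_iff less_Suc_eq_le)
  \<comment> \<open>Columns after the inserted one are numbered one higher than in \<open>A\<close>,
    hence the \<open>- 1\<close>.\<close>
  define c where "c = (\<lambda>b. if b < q then c' b else c' (Suc b) - 1)"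
  have low: "c' b < p" if "b < q" for b
    using increasing_index_less[OF c', of b q] that q by simp
  have high: "p < c' b" if "q < b" "b \<le> k" for b
    using increasing_index_less[OF c', of q b] that q by simp
  have "c a < c b" if "a < b" "b < k" for a b
    using that q increasing_index_less[OF c', of a b] increasing_index_less[OF c', of a "Suc b"]
      increasing_index_less[OF c', of "Suc a" "Suc b"] low[of a] high[of "Suc a"] high[of "Suc b"]
    by (auto simp: c_def)
  moreover have "c b < n" if "b < k" for b
    using that q increasing_index_bound[OF c', of "Suc b"] low[of b] high[of "Suc b"] p
    by (auto simp: c_def)
  ultimately have c: "increasing_index k n c"
    by (auto simp: increasing_index_def strict_mono_on_def)
  have "c ` {..<k} \<inter> {..<p} = c ` {..<q}"
  proof -
    have "c b < p \<longleftrightarrow> b < q" if "b < k" for b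
      using that low[of b] high[of "Suc b"] by (auto simp: c_def)
    then show ?thesis using q by auto
  qed
  then have card: "card (c ` {..<k} \<inter> {..<p}) = q"
    using inj_on_subset[OF increasing_index_inj[OF c], of "{..<q}"] q by (simp add: card_image)
  have "minor (insert_col p v A) (Suc k) r c' =
       (-1) ^ card (c ` {..<k} \<inter> {..<p}) * bordered_minor A k r c (\<lambda>i. v $ i)" for v
    unfolding minor_def card
  proof (rule det_column_at)
    fix a b assume a: "a \<le> k" and b: "b < k"
    have ra: "r a < m" using increasing_index_bound[OF r] a by simp
    have "c' (if b < q then b else Suc b) < Suc n"
      using increasing_index_bound[OF c'] b by simp
    then show "(case (a, if b < q then b else Suc b) of (a, b) \<Rightarrow> insert_col p v A $$ (r a, c' b)) = A $$ (r a, c b)"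
      using ra b low[of b] high[of "Suc b"] A by (auto simp: insert_col_def c_def)
  next
    fix a assume "a \<le> k"
    then have "r a < m" using increasing_index_bound[OF r] by simp
    then show "(case (a, q) of (a, b) \<Rightarrow> insert_col p v A $$ (r a, c' b)) = v $ r a"
      using q p A by (auto simp: insert_col_def)
  qed (rule q)
  with c show ?thesis by (rule that)
qed

lemma minor_insert_col_avoid:
  assumes A: "A \<in> carrier_mat m n" and p: "p \<le> n"
    and r: "increasing_index k m r" and c': "increasing_index k (Suc n) c'"
    and mem: "p \<notin> c' ` {..<k}"
  obtains c where "increasing_index k n c" "\<And>v. minor (insert_col p v A) k r c' = minor A k r c"
proof
  define c where "c = (\<lambda>b. if c' b < p then c' b else c' b - 1)"
  have neq: "c' b \<noteq> p" if "b < k" for b using mem that by auto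
  have "c a < c b" if "a < b" "b < k" for a b
    using that increasing_index_less[OF c', of a b] neq[of a] neq[of b]
    by (auto simp: c_def)
  moreover have "c b < n" if "b < k" for b
    using that increasing_index_bound[OF c', of b] neq[of b] p by (auto simp: c_def)
  ultimately show "increasing_index k n c"
    by (auto simp: increasing_index_def strict_mono_on_def)
  show "minor (insert_col p v A) k r c' = minor A k r c" for v
    unfolding minor_def
    by (rule arg_cong[where f = det])
      (use A neq increasing_index_bound[OF r] increasing_index_bound[OF c'] in
        \<open>auto intro!: eq_matI simp: insert_col_def c_def\<close>)
qed

text \<open>As \<open>r\<close> is injective, only the term of row \<open>r 0\<close> survives, with
  sign \<open>(-1) ^ 0\<close>.\<close>

lemma bordered_minor_unit:
  assumes "increasing_index (Suc k) m r"
  shows "bordered_minor A k r c (\<lambda>i. if i = r 0 then 1 else 0) = minor A k (\<lambda>i. r (Suc i)) c"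
proof -
  have "bordered_minor A k r c (\<lambda>i. if i = r 0 then 1 else 0) =
    (\<Sum>a<Suc k. if a = 0 then minor A k (\<lambda>i. r (Suc i)) c else 0)"
    unfolding bordered_minor_def
  proof (rule sum.cong)
    fix a assume "a \<in> {..<Suc k}"
    then show "(-1) ^ a * (if r a = r 0 then 1 else 0) * minor A k (\<lambda>i. r (if i < a then i else Suc i)) c =
      (if a = 0 then minor A k (\<lambda>i. r (Suc i)) c else 0)"
      using increasing_index_less[OF assms, of 0 a] by (cases "a = 0") auto
  qed simp
  then show ?thesis by simp
qed

text \<open>\<open>r 0\<close> is the least row of the minor, so the support of the vector misses
  all its rows.\<close>

lemma bordered_minor_unit_below:
  assumes "increasing_index (Suc k) m r" "i0 < r 0"
  shows "bordered_minor A k r c (\<lambda>i. if i = i0 then x else 0) = 0"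
proof -
  have "r a \<noteq> i0" if "a \<le> k" for a
    using increasing_index_less[OF assms(1), of 0 a] that assms(2) by (cases "a = 0") auto
  then show ?thesis unfolding bordered_minor_def by (intro sum.neutral) auto
qed


section \<open>Sign of the lowest-order term\<close>

text \<open>Dividing by \<open>d ^ t0\<close> leaves a polynomial with value \<open>a t0\<close> at
  0. By continuity it keeps this sign nearby, and \<open>d ^ t0\<close> is positive for
  \<open>d > 0\<close>.\<close>

lemma eventually_sgn_leading_coeff:
  fixes a :: "nat \<Rightarrow> real"
  assumes "t0 < N" "a t0 \<noteq> 0" "\<And>t. t < t0 \<Longrightarrow> a t = 0"
  shows "eventually (\<lambda>d. sgn (\<Sum>t<N. d ^ t * a t) = sgn (a t0)) (at_right 0)"
proof -
  define g where "g d = (\<Sum>t\<in>{t0..<N}. d ^ (t - t0) * a t)" for d :: real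
  have eq: "(\<Sum>t<N. d ^ t * a t) = d ^ t0 * g d" for d
  proof -
    have "(\<Sum>t<N. d ^ t * a t) = (\<Sum>t\<in>{t0..<N}. d ^ t * a t)"
      by (rule sum.mono_neutral_right) (auto simp: assms(3))
    also have "\<dots> = d ^ t0 * g d"
      unfolding g_def sum_distrib_left
      by (rule sum.cong) (auto simp: power_add[symmetric] mult.assoc[symmetric])
    finally show ?thesis .
  qed
  have "g 0 = (\<Sum>t\<in>{t0..<N}. if t = t0 then a t0 else 0)"
    unfolding g_def by (rule sum.cong) auto
  then have g0: "g 0 = a t0" using assms(1) by simp
  have "isCont g 0" unfolding g_def by (intro continuous_intros)
  then have "(g \<longlongrightarrow> a t0) (at_right 0)"
    using g0 filterlim_at_split[of g "nhds (a t0)" 0] by (simp add: isCont_def)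
  then have "eventually (\<lambda>d. sgn (g d) = sgn (a t0)) (at_right 0)"
  proof (cases "a t0 > 0")
    case True
    then show ?thesis using order_tendstoD(1)[OF \<open>(g \<longlongrightarrow> a t0) (at_right 0)\<close>, of 0]
      by (auto elim!: eventually_mono)
  next
    case False
    then have "a t0 < 0" using assms(2) by simp
    then show ?thesis using order_tendstoD(2)[OF \<open>(g \<longlongrightarrow> a t0) (at_right 0)\<close>, of 0]
      by (auto elim!: eventually_mono)
  qed
  then show ?thesis
    using eventually_at_right_less[of 0]
    by eventually_elim (simp add: eq sgn_mult)
qed


section \<open>The inserted column\<close>

text \<open>Lists the columns going left from the gap before column \<open>p\<close>, then right
  from it. The map is its own inverse.\<close>

definition column_order :: "nat \<Rightarrow> nat \<Rightarrow> nat" where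
  "column_order p t = (if t < p then p - 1 - t else t)"

text \<open>Signs alternate on each side of the gap, starting afresh with plus next to it. The
  factor \<open>x\<close> is the common coefficient of the unit vectors, kept as a parameter until
  the sign of the largest minors is chosen.\<close>

definition insertion_term :: "real mat \<Rightarrow> nat \<Rightarrow> real \<Rightarrow> nat \<Rightarrow> nat \<Rightarrow> real" where
  "insertion_term A p x t i =
     (if t < dim_col A then (if t < p then (-1) ^ t else (-1) ^ (t - p)) * A $$ (i, column_order p t)
      else if i = t - dim_col A then x else 0)"

definition inserted_column :: "real mat \<Rightarrow> nat \<Rightarrow> real \<Rightarrow> real \<Rightarrow> real vec" where
  "inserted_column A p x d =
     vec (dim_row A) (\<lambda>i. \<Sum>t<dim_col A + dim_row A. d ^ t * insertion_term A p x t i)"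

lemma bordered_minor_insertion_term_column:
  assumes "A \<in> carrier_mat m n" "t < n"
  shows "bordered_minor A k r c (insertion_term A p x t) =
    (if t < p then (-1) ^ t else (-1) ^ (t - p)) * bordered_minor A k r c (\<lambda>i. A $$ (i, column_order p t))"
  unfolding bordered_minor_scale[symmetric] insertion_term_def using assms by simp

lemma card_below_gap:
  fixes K :: "nat set"
  assumes "j < p" "j \<notin> K" "{j<..<p} \<subseteq> K"
  shows "card (K \<inter> {..<p}) = card (K \<inter> {..<j}) + (p - 1 - j)"
proof -
  have "K \<inter> {..<p} = (K \<inter> {..<j}) \<union> {j<..<p}"
    using assms by (auto simp: subset_iff)
  moreover have "card \<dots> = card (K \<inter> {..<j}) + card {j<..<p}"
    by (rule card_Un_disjoint) auto
  ultimately show ?thesis by simp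
qed

text \<open>For \<open>t < p\<close> the \<open>t\<close> columns strictly between the first missing
  one and the gap all lie in \<open>K\<close>, so the two cardinalities differ by \<open>t\<close>.
  Otherwise \<open>K\<close> contains all columns below \<open>t\<close>, and the cardinalities are
  \<open>p\<close> and \<open>t\<close>.\<close>

lemma neg_one_power_column_order:
  assumes "p \<le> n" "t < n" "column_order p t \<notin> K"
    and prev: "\<And>t'. t' < t \<Longrightarrow> column_order p t' \<in> K"
  shows "(-1) ^ card (K \<inter> {..<p}) * (if t < p then (-1) ^ t else (-1) ^ (t - p)) =
    ((-1) ^ card (K \<inter> {..<column_order p t}) :: real)"
proof (cases "t < p")
  case True
  have "{p - 1 - t<..<p} \<subseteq> K"
  proof
    fix x assume "x \<in> {p - 1 - t<..<p}"
    then show "x \<in> K" using prev[of "p - 1 - x"] True by (auto simp: column_order_def)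
  qed
  then have "card (K \<inter> {..<p}) = card (K \<inter> {..<column_order p t}) + t"
    using card_below_gap[of "p - 1 - t" p K] True assms(3) by (simp add: column_order_def)
  then show ?thesis using True by (simp add: power_add)
next
  case False
  have "x \<in> K" if "x < t" for x
    using that prev[of x] prev[of "p - 1 - x"] False by (cases "x < p") (auto simp: column_order_def)
  then have "K \<inter> {..<p} = {..<p}" "K \<inter> {..<t} = {..<t}" using False by auto
  moreover have "(-1) ^ t = ((-1) ^ p * (-1) ^ (t - p) :: real)"
    using False by (simp flip: power_add)
  ultimately show ?thesis using False by (simp add: column_order_def)
qed

text \<open>The leading term belongs to the first old column missing from the minor or, if none is
  missing, to the unit vector of the first row of the minor.\<close>

lemma insertion_term_leading:
  assumes A: "A \<in> carrier_mat m n" "SSR eps A" and eps: "sign_pattern (min m n) eps"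
    and n: "n \<ge> 1" and p: "p \<le> n" and s: "s \<in> {1, -1}"
    and r: "increasing_index (Suc k) m r" and c: "increasing_index k n c"
    and k: "Suc k \<le> min m (n + 1)"
  defines "u \<equiv> insertion_term A p (s * eps n * (-1) ^ p)"
  shows "\<exists>t0<n + m. (\<forall>t<t0. bordered_minor A k r c (u t) = 0) \<and>
    bordered_minor A k r c (u t0) \<noteq> 0 \<and>
    sgn ((-1) ^ card (c ` {..<k} \<inter> {..<p}) * bordered_minor A k r c (u t0)) = (eps(n + 1 := s)) (Suc k)"
proof -
  let ?K = "c ` {..<k}"
  have order_bound: "column_order p t < n" if "t < n" for t
    using that p by (auto simp: column_order_def)
  have old: "bordered_minor A k r c (u t) = 0" if "t < n" "column_order p t \<in> ?K" for t
    using that bordered_minor_old_column[of _ k A r c]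
    by (auto simp: u_def bordered_minor_insertion_term_column[OF A(1) that(1)])
  have K: "?K \<subseteq> {..<n}" "card ?K = k"
    using c increasing_index_image_bound increasing_index_card by auto
  show ?thesis
  proof (cases "?K = {..<n}")
    case False
    with K(1) obtain x where x: "x < n" "x \<notin> ?K" by auto
    \<comment> \<open>Hence \<open>Suc k\<close> is at most \<open>n\<close>, and the updated
      pattern agrees with \<open>eps\<close> there.\<close>
    have "k < n" using K False psubset_card_mono[of "{..<n}" ?K] by auto
    define P where "P t \<longleftrightarrow> t < n \<and> column_order p t \<notin> ?K" for t
    \<comment> \<open>\<open>column_order p\<close> is an involution, so the missing column
      \<open>x\<close> comes up at position \<open>column_order p x\<close>.\<close>
    have "P (column_order p x)" using x p by (auto simp: P_def column_order_def)
    then have t0: "P (LEAST t. P t)" by (rule LeastI)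
    define t0 where "t0 = (LEAST t. P t)"
    have t0: "t0 < n" "column_order p t0 \<notin> ?K" using t0 by (auto simp: P_def t0_def)
    have prev: "column_order p t \<in> ?K" if "t < t0" for t
      using not_less_Least[of t P] that t0 by (auto simp: P_def t0_def)
    obtain c' where c': "increasing_index (Suc k) n c'"
      "\<And>r. minor A (Suc k) r c' = (-1) ^ card (?K \<inter> {..<column_order p t0}) *
         bordered_minor A k r c (\<lambda>i. A $$ (i, column_order p t0))"
      using bordered_minor_new_column[OF c order_bound[OF t0(1)] t0(2)] by blast
    have *: "minor A (Suc k) r c' \<noteq> 0 \<and> sgn (minor A (Suc k) r c') = eps (Suc k)"
      using A(2) r c'(1) k \<open>k < n\<close> unfolding SSR_iff_minor[OF A(1)] by simp
    \<comment> \<open>The sign of position \<open>p\<close> and the sign inside \<open>u t0\<close>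
      combine to the sign of sorting the column in, so the result is a genuine minor of
      \<open>A\<close>.\<close>
    have eq: "(-1) ^ card (?K \<inter> {..<p}) * bordered_minor A k r c (u t0) = minor A (Suc k) r c'"
      unfolding c'(2) u_def bordered_minor_insertion_term_column[OF A(1) t0(1)] mult.assoc[symmetric]
      using neg_one_power_column_order[OF p t0(1,2) prev] by simp
    show ?thesis
    proof (intro exI[of _ t0] conjI allI impI)
      show "bordered_minor A k r c (u t) = 0" if "t < t0" for t
        using old[of t] prev[OF that] that t0 by simp
      show "bordered_minor A k r c (u t0) \<noteq> 0" using eq * by auto
    qed (use t0 eq * \<open>k < n\<close> in auto)
  next
    case True
    \<comment> \<open>All old columns occur, so this is a minor of size
      \<open>n + 1\<close>.\<close>
    then have "k = n" using K(2) by simp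
    have r0: "r 0 < m" using increasing_index_bound[OF r] by simp
    have r': "increasing_index k m (\<lambda>i. r (Suc i))"
      using increasing_index_less[OF r] increasing_index_bound[OF r]
      by (auto simp: increasing_index_def strict_mono_on_def)
    have unit: "u (n + i0) = (\<lambda>i. if i = i0 then s * eps n * (-1) ^ p else 0)" for i0
      using A by (auto simp: u_def insertion_term_def)
    define M where "M = minor A k (\<lambda>i. r (Suc i)) c"
    have "u (n + r 0) = (\<lambda>i. s * eps n * (-1) ^ p * (if i = r 0 then 1 else 0))"
      unfolding unit by auto
    then have lead: "bordered_minor A k r c (u (n + r 0)) = s * eps n * (-1) ^ p * M"
      by (simp only: bordered_minor_scale bordered_minor_unit[OF r] M_def)
    have M: "M \<noteq> 0 \<and> sgn M = eps n"
      using A(2) r' c k n \<open>k = n\<close> unfolding SSR_iff_minor[OF A(1)] M_def by auto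
    have eps_n: "eps n = 1 \<or> eps n = -1"
      using eps k n \<open>k = n\<close> by (auto simp: sign_pattern_def)
    have cardp: "card (?K \<inter> {..<p}) = p"
      using True p by (simp add: Int_absorb1 lessThan_subset_iff)
    have pp: "(-1) ^ p * (-1) ^ p = (1 :: real)" by (simp flip: power_mult_distrib)
    show ?thesis
    proof (intro exI[of _ "n + r 0"] conjI allI impI)
      show "bordered_minor A k r c (u t) = 0" if "t < n + r 0" for t
      proof (cases "t < n")
        case t: True
        then show ?thesis using old[of t] order_bound[of t] True by simp
      next
        case False
        then have "t = n + (t - n)" "t - n < r 0" using that by auto
        then show ?thesis
          using bordered_minor_unit_below[OF r] unit[of "t - n"] by simp
      qed
      show "bordered_minor A k r c (u (n + r 0)) \<noteq> 0"
        using s eps_n M by (auto simp: lead)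
      \<comment> \<open>The \<open>(-1) ^ p\<close> put into the coefficient cancels the sign of
        position \<open>p\<close>. Then \<open>eps n\<close> cancels the sign of \<open>M\<close>,
        and \<open>s\<close> remains.\<close>
      have flip: "(-1) ^ p * (s * eps n * (-1) ^ p * M) = s * eps n * M"
        using pp by (simp add: mult_ac)
      show "sgn ((-1) ^ card (?K \<inter> {..<p}) * bordered_minor A k r c (u (n + r 0))) =
          (eps(n + 1 := s)) (Suc k)"
        unfolding lead cardp flip using s eps_n M \<open>k = n\<close> by (auto simp: sgn_mult)
    qed (use r0 in auto)
  qed
qed

section \<open>Sign regularity of the extended matrix for small \<open>d\<close>\<close>

lemma eventually_minor_inserted_column:
  assumes A: "A \<in> carrier_mat m n" "SSR eps A" and eps: "sign_pattern (min m n) eps"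
    and n: "n \<ge> 1" and p: "p \<le> n" and s: "s \<in> {1, -1}"
    and k: "1 \<le> k" "k \<le> min m (n + 1)"
    and r: "increasing_index k m r" and c': "increasing_index k (n + 1) c'"
  shows "eventually (\<lambda>d. sgn (minor (insert_col p (inserted_column A p (s * eps n * (-1) ^ p) d) A) k r c') =
    (eps(n + 1 := s)) k) (at_right 0)"
proof (cases "p \<in> c' ` {..<k}")
  case False
  have c'': "increasing_index k (Suc n) c'" using c' by simp
  obtain c where c: "increasing_index k n c" "\<And>v. minor (insert_col p v A) k r c' = minor A k r c"
    using minor_insert_col_avoid[OF A(1) p r c'' False] by blast
  \<comment> \<open>A minor avoiding the inserted column uses only the \<open>n\<close> columns of
    \<open>A\<close>, so its size is not \<open>n + 1\<close>.\<close>
  have "k \<le> n"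
    using increasing_index_card[OF c(1)] increasing_index_image_bound[OF c(1)]
      card_mono[of "{..<n}" "c ` {..<k}"] by simp
  then have "sgn (minor A k r c) = eps k" "k \<noteq> n + 1"
    using A(2) r c(1) k unfolding SSR_iff_minor[OF A(1)] by auto
  then show ?thesis using c(2) by simp
next
  case True
  obtain l where l: "k = Suc l" using k(1) by (cases k) auto
  let ?x = "s * eps n * (-1) ^ p"
  obtain c where c: "increasing_index l n c"
    "\<And>v. minor (insert_col p v A) (Suc l) r c' =
       (-1) ^ card (c ` {..<l} \<inter> {..<p}) * bordered_minor A l r c (\<lambda>i. v $ i)"
    using minor_insert_col[OF A(1) p, of l r c'] r c' True l by auto
  define e where "e = ((-1) ^ card (c ` {..<l} \<inter> {..<p}) :: real)"
  define B where "B t = bordered_minor A l r c (insertion_term A p ?x t)" for t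
  obtain t0 where t0: "t0 < n + m" "\<And>t. t < t0 \<Longrightarrow> B t = 0" "B t0 \<noteq> 0"
    "sgn (e * B t0) = (eps(n + 1 := s)) (Suc l)"
    using insertion_term_leading[OF A eps n p s, of l r c] r c(1) k
    unfolding l B_def e_def by auto
  \<comment> \<open>Linearity in the bordering column makes the minor a polynomial in
    \<open>d\<close>, with coefficients independent of \<open>d\<close>.\<close>
  have "minor (insert_col p (inserted_column A p ?x d) A) (Suc l) r c' =
      e * (\<Sum>t<n + m. d ^ t * B t)" for d
  proof -
    have "bordered_minor A l r c (\<lambda>i. inserted_column A p ?x d $ i) =
      bordered_minor A l r c (\<lambda>i. \<Sum>t<n + m. d ^ t * insertion_term A p ?x t i)"
      by (rule bordered_minor_cong)
        (use A r increasing_index_bound l in \<open>auto simp: inserted_column_def\<close>)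
    then show ?thesis by (simp add: c(2) e_def bordered_minor_sum B_def)
  qed
  moreover have "eventually (\<lambda>d. sgn (\<Sum>t<n + m. d ^ t * B t) = sgn (B t0)) (at_right 0)"
    by (rule eventually_sgn_leading_coeff) (use t0 in auto)
  ultimately show ?thesis
    using t0(4) unfolding l by (auto simp: sgn_mult elim!: eventually_mono)
qed

text \<open>Each minor has the right sign for all small \<open>d > 0\<close>. There are finitely
  many minors, so one \<open>d\<close> serves them all.\<close>

lemma SSR_insert_col:
  assumes A: "A \<in> carrier_mat m n" "SSR eps A" and eps: "sign_pattern (min m n) eps"
    and n: "n \<ge> 1" and p: "p \<le> n" and s: "s \<in> {1, -1}"
  obtains v where "v \<in> carrier_vec m" "SSR (eps(n + 1 := s)) (insert_col p v A)"
proof -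
  define w where "w = inserted_column A p (s * eps n * (-1) ^ p)"
  have w: "w d \<in> carrier_vec m" for d using A by (simp add: w_def inserted_column_def)
  have ins: "insert_col p v A \<in> carrier_mat m (n + 1)" for v
    using A by (auto simp: insert_col_def)
  \<comment> \<open>The quantifiers range over index sets, which are finite in number. Index
    functions are not, being arbitrary outside \<open>{..<k}\<close>.\<close>
  have "eventually (\<lambda>d. \<forall>k\<in>{1..min m (n + 1)}. \<forall>I\<in>Pow {..<m}. \<forall>J\<in>Pow {..<n + 1}.
      card I = k \<and> card J = k \<longrightarrow>
      sgn (det (submatrix (insert_col p (w d) A) I J)) = (eps(n + 1 := s)) k) (at_right 0)"
  proof (intro eventually_ball_finite ballI)
    fix k I J
    assume k: "k \<in> {1..min m (n + 1)}" and I: "I \<in> Pow {..<m}" and J: "J \<in> Pow {..<n + 1}"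
    show "eventually (\<lambda>d. card I = k \<and> card J = k \<longrightarrow>
      sgn (det (submatrix (insert_col p (w d) A) I J)) = (eps(n + 1 := s)) k) (at_right 0)"
    proof (cases "card I = k \<and> card J = k")
      case True
      obtain r where r: "increasing_index k m r" "I = r ` {..<k}"
        using obtain_increasing_index[of I m k] I True by auto
      obtain c where c: "increasing_index k (n + 1) c" "J = c ` {..<k}"
        using obtain_increasing_index[of J "n + 1" k] J True by auto
      show ?thesis
        using eventually_minor_inserted_column[OF A eps n p s, of k r c] k r c
        unfolding det_submatrix_image[OF ins r(1) c(1), folded r(2) c(2)] w_def
        by (auto elim!: eventually_mono)
    qed auto
  qed auto
  then obtain d where d: "\<forall>k\<in>{1..min m (n + 1)}. \<forall>I\<in>Pow {..<m}. \<forall>J\<in>Pow {..<n + 1}.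
      card I = k \<and> card J = k \<longrightarrow>
      sgn (det (submatrix (insert_col p (w d) A) I J)) = (eps(n + 1 := s)) k"
    using eventually_happens'[OF trivial_limit_at_right_real] by blast
  \<comment> \<open>A nonzero prescribed sign also forces the determinant to be nonzero.\<close>
  have nz: "(eps(n + 1 := s)) k \<noteq> 0" if "k \<in> {1..min m (n + 1)}" for k
  proof (cases "k = n + 1")
    case False
    then have "k \<in> {1..min m n}" using that by auto
    then have "eps k \<in> {1, -1}" using eps unfolding sign_pattern_def by blast
    then show ?thesis using False by auto
  qed (use s in auto)
  have "SSR (eps(n + 1 := s)) (insert_col p (w d) A)"
    unfolding SSR_def
  proof (intro ballI allI impI)
    fix k I J
    assume *: "k \<in> {1..min (dim_row (insert_col p (w d) A)) (dim_col (insert_col p (w d) A))}"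
      "I \<subseteq> {..<dim_row (insert_col p (w d) A)} \<and> J \<subseteq> {..<dim_col (insert_col p (w d) A)} \<and>
       card I = k \<and> card J = k"
    have dims: "dim_row (insert_col p (w d) A) = m" "dim_col (insert_col p (w d) A) = n + 1"
      using ins[of "w d"] by auto
    have "sgn (det (submatrix (insert_col p (w d) A) I J)) = (eps(n + 1 := s)) k"
      using d * unfolding dims by blast
    then show "det (submatrix (insert_col p (w d) A) I J) \<noteq> 0 \<and>
        sgn (det (submatrix (insert_col p (w d) A) I J)) = (eps(n + 1 := s)) k"
      using nz[of k] *(1) unfolding dims by auto
  qed
  then show ?thesis using that w by blast
qed

lemma SSR_insert_row:
  assumes A: "A \<in> carrier_mat m n" "SSR eps A" and eps: "sign_pattern (min m n) eps"
    and m: "m \<ge> 1" and p: "p \<le> m" and s: "s \<in> {1, -1}"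
  obtains v where "v \<in> carrier_vec n" "SSR (eps(m + 1 := s)) (insert_row p v A)"
proof -
  obtain v where v: "v \<in> carrier_vec n" "SSR (eps(m + 1 := s)) (insert_col p v (transpose_mat A))"
    using SSR_insert_col[of "transpose_mat A" n m eps p s] A SSR_transpose eps m p s
    by (auto simp: min.commute)
  then show ?thesis
    using that SSR_transpose[OF v(2)] insert_row_transpose[OF A(1) v(1) p] by simp
qed

theorem theoremB:
  fixes m n :: nat and eps :: "nat \<Rightarrow> real" and A :: "real mat"
  assumes "m \<ge> 1" and "n \<ge> 1"
    and "sign_pattern (min m n) eps"
    and "A \<in> carrier_mat m n"
    and "SSR eps A"
  shows
    "(\<forall>p. 0 < p \<and> p < n \<longrightarrow>
       (\<exists>v\<in>carrier_vec m. \<exists>eps'.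
          sign_pattern (min m (n + 1)) eps' \<and>
          (\<forall>i\<in>{1..min m n}. eps' i = eps i) \<and>
          SSR eps' (insert_col p v A)) \<and>
       (min m n + 1 \<le> min m (n + 1) \<longrightarrow>
          (\<forall>s\<in>{1, -1}. \<exists>v\<in>carrier_vec m. \<exists>eps'.
             sign_pattern (min m (n + 1)) eps' \<and>
             (\<forall>i\<in>{1..min m n}. eps' i = eps i) \<and>
             eps' (min m n + 1) = s \<and>
             SSR eps' (insert_col p v A))))
     \<and>
     (\<forall>p. 0 < p \<and> p < m \<longrightarrow>
       (\<exists>v\<in>carrier_vec n. \<exists>eps'.
          sign_pattern (min (m + 1) n) eps' \<and>
          (\<forall>i\<in>{1..min m n}. eps' i = eps i) \<and>
          SSR eps' (insert_row p v A)) \<and>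
       (min m n + 1 \<le> min (m + 1) n \<longrightarrow>
          (\<forall>s\<in>{1, -1}. \<exists>v\<in>carrier_vec n. \<exists>eps'.
             sign_pattern (min (m + 1) n) eps' \<and>
             (\<forall>i\<in>{1..min m n}. eps' i = eps i) \<and>
             eps' (min m n + 1) = s \<and>
             SSR eps' (insert_row p v A))))"
proof -
  \<comment> \<open>The updated positions \<open>n + 1\<close> and \<open>m + 1\<close> lie outside
    \<open>{1..min m n}\<close>, so both patterns extend \<open>eps\<close>.\<close>
  have pat: "sign_pattern (min m (n + 1)) (eps(n + 1 := s))" "sign_pattern (min (m + 1) n) (eps(m + 1 := s))"
    if "s \<in> {1, -1}" for s
    using that assms(3) by (auto simp: sign_pattern_def)
  have col: "\<exists>v\<in>carrier_vec m. SSR (eps(n + 1 := s)) (insert_col p v A)"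
    if "p < n" "s \<in> {1, -1}" for p s
    using SSR_insert_col[OF assms(4,5,3,2) _ that(2)] that(1) by (metis less_imp_le)
  have row: "\<exists>v\<in>carrier_vec n. SSR (eps(m + 1 := s)) (insert_row p v A)"
    if "p < m" "s \<in> {1, -1}" for p s
    using SSR_insert_row[OF assms(4,5,3,1) _ that(2)] that(1) by (metis less_imp_le)
  show ?thesis
  proof (intro conjI allI impI ballI)
    fix p assume "0 < p \<and> p < n"
    then obtain v where "v \<in> carrier_vec m" "SSR (eps(n + 1 := 1)) (insert_col p v A)"
      using col[of p 1] by auto
    then show "\<exists>v\<in>carrier_vec m. \<exists>eps'. sign_pattern (min m (n + 1)) eps' \<and>
        (\<forall>i\<in>{1..min m n}. eps' i = eps i) \<and> SSR eps' (insert_col p v A)"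
      using pat(1)[of 1] by (intro bexI[of _ v] exI[of _ "eps(n + 1 := 1)"]) auto
  next
    fix p s assume "0 < p \<and> p < n" "min m n + 1 \<le> min m (n + 1)" and s: "s \<in> {1, - 1 :: real}"
    \<comment> \<open>The size condition forces \<open>n < m\<close>, so the updated position
      \<open>n + 1\<close> is exactly \<open>min m n + 1\<close>.\<close>
    then obtain v where "v \<in> carrier_vec m" "SSR (eps(n + 1 := s)) (insert_col p v A)" "min m n = n"
      using col[of p s] by auto
    then show "\<exists>v\<in>carrier_vec m. \<exists>eps'. sign_pattern (min m (n + 1)) eps' \<and>
        (\<forall>i\<in>{1..min m n}. eps' i = eps i) \<and> eps' (min m n + 1) = s \<and> SSR eps' (insert_col p v A)"
      using pat(1)[OF s] by (intro bexI[of _ v] exI[of _ "eps(n + 1 := s)"]) auto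
  next
    fix p assume "0 < p \<and> p < m"
    then obtain v where "v \<in> carrier_vec n" "SSR (eps(m + 1 := 1)) (insert_row p v A)"
      using row[of p 1] by auto
    then show "\<exists>v\<in>carrier_vec n. \<exists>eps'. sign_pattern (min (m + 1) n) eps' \<and>
        (\<forall>i\<in>{1..min m n}. eps' i = eps i) \<and> SSR eps' (insert_row p v A)"
      using pat(2)[of 1] by (intro bexI[of _ v] exI[of _ "eps(m + 1 := 1)"]) auto
  next
    fix p s assume "0 < p \<and> p < m" "min m n + 1 \<le> min (m + 1) n" and s: "s \<in> {1, - 1 :: real}"
    then obtain v where "v \<in> carrier_vec n" "SSR (eps(m + 1 := s)) (insert_row p v A)" "min m n = m"
      using row[of p s] by auto
    then show "\<exists>v\<in>carrier_vec n. \<exists>eps'. sign_pattern (min (m + 1) n) eps' \<and>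
        (\<forall>i\<in>{1..min m n}. eps' i = eps i) \<and> eps' (min m n + 1) = s \<and> SSR eps' (insert_row p v A)"
      using pat(2)[OF s] by (intro bexI[of _ v] exI[of _ "eps(m + 1 := s)"]) auto
  qed
qed

end
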